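(* The graph $\{(r,\tau_{\mathcal F}(r)):r\in\mathbb{Q}\cap[0,1]\}$ of the Farey twist function $\tau_{\mathcal F}:\mathbb{Q}\cap[0,1]\to[0,1]$ is dense in $[0,1]\times[0,1]$.
   Context: Vertices of the Farey graph are $\mathbb{Q}\cup\{\infty\}$, with $\infty=\frac10$ (regarded as larger than every rational) and all other fractions written in lowest terms with positive denominator; $\frac pq$ and $\frac ab$ are adjacent iff $|pb-qa|=1$. For $\frac pq\in\mathbb{Q}$ there is a unique pair $\left(\frac ab,\frac cd\right)$, called its immediate precedents, such that $\frac ab<\frac pq<\frac cd$ are pairwise adjacent, $a+c=p$ and $b+d=q$ (so the pair is $(\frac{-1}{1},\frac10)$ for $\frac01$ and $(\frac01,\frac10)$ for $\frac11$). The Farey twist function is $\tau_{\mathcal F}:\mathbb{Q}\cap[0,1]\to\mathbb{Q}\cap[0,1]$, $\tau_{\mathcal F}(p/q)=b/q$. *)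

theory Defs
  imports "HOL-Analysis.Analysis"
begin

datatype farey_vertex = Fin rat | Infty

text \<open>\<^const>\<open>quotient_of\<close> is the representation in lowest terms with positive denominator;
  \<^term>\<open>Infty\<close> is the fraction 1/0.\<close>

fun farey_num :: "farey_vertex \<Rightarrow> int" where
  "farey_num (Fin r) = fst (quotient_of r)"
| "farey_num Infty = 1"

fun farey_den :: "farey_vertex \<Rightarrow> int" where
  "farey_den (Fin r) = snd (quotient_of r)"
| "farey_den Infty = 0"

fun farey_less :: "farey_vertex \<Rightarrow> farey_vertex \<Rightarrow> bool" where
  "farey_less (Fin r) (Fin s) \<longleftrightarrow> r < s"
| "farey_less (Fin r) Infty \<longleftrightarrow> True"
| "farey_less Infty v \<longleftrightarrow> False"

definition farey_adjacent :: "farey_vertex \<Rightarrow> farey_vertex \<Rightarrow> bool" where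
  "farey_adjacent u v \<longleftrightarrow> \<bar>farey_num u * farey_den v - farey_den u * farey_num v\<bar> = 1"

definition immediate_precedents :: "rat \<Rightarrow> farey_vertex \<times> farey_vertex \<Rightarrow> bool" where
  "immediate_precedents r = (\<lambda>(u, v).
     farey_less u (Fin r) \<and> farey_less (Fin r) v \<and>
     farey_adjacent u (Fin r) \<and> farey_adjacent (Fin r) v \<and> farey_adjacent u v \<and>
     farey_num u + farey_num v = farey_num (Fin r) \<and>
     farey_den u + farey_den v = farey_den (Fin r))"

lemma quotient_of_Fract_coprime:
  "coprime a b \<Longrightarrow> b > 0 \<Longrightarrow> quotient_of (Fract a b) = (a, b)"
  by (simp add: quotient_of_Fract normalize_def)

lemma Fract_less_quotient_of:
  assumes "quotient_of r = (a, b)" "quotient_of s = (c, d)"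
  shows "r < s \<longleftrightarrow> a * d < c * b"
proof -
  have "b > 0" "d > 0"
    using assms quotient_of_denom_pos by blast+
  moreover have "r = of_int a / of_int b" "s = of_int c / of_int d"
    using assms quotient_of_div by blast+
  ultimately have "r < s \<longleftrightarrow> (of_int a * of_int d :: rat) < of_int c * of_int b"
    by (simp only: of_int_0_less_iff divide_less_eq less_divide_eq if_True times_divide_eq_left)
  then show ?thesis
    by (simp flip: of_int_mult)
qed

lemma ex1_immediate_precedents: "\<exists>!uv. immediate_precedents r uv"
proof -
  obtain p q where r: "quotient_of r = (p, q)"
    by fastforce
  then have q: "q > 0" and cop: "coprime p q"
    using quotient_of_denom_pos quotient_of_coprime by blast+
  have ex: "\<exists>uv. immediate_precedents r uv"
  proof -
    obtain x y where xy: "p * x + q * y = 1"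
      using cop by (metis bezout_int coprime_imp_gcd_eq_1 mult.commute)
    define k where "k = (x - 1) div q"
    define b where "b = x - k * q"
    define a where "a = - y - k * p"
    have bez: "p * b - q * a = 1"
      using xy by (simp add: a_def b_def algebra_simps)
    have bm: "b = (x - 1) mod q + 1"
      by (simp add: b_def k_def minus_div_mult_eq_mod [symmetric])
    have b: "1 \<le> b" "b \<le> q"
      unfolding bm using pos_mod_bound [OF q, of "x - 1"] pos_mod_sign [OF q, of "x - 1"] by linarith+
    have copab: "coprime a b"
    proof (rule coprimeI)
      fix c assume "c dvd a" "c dvd b"
      then have "c dvd p * b - q * a" by simp
      then show "is_unit c" using bez by simp
    qed
    define u where "u = Fin (Fract a b)"
    have u: "quotient_of (Fract a b) = (a, b)"
      using copab b by (intro quotient_of_Fract_coprime) auto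
    show ?thesis
    proof (cases "b = q")
      case True
      have "q * (p - a) = 1" using bez True by (simp add: algebra_simps)
      then have "q = 1" "p - a = 1" using q
        by (auto simp: zmult_eq_1_iff)
      then have "immediate_precedents r (u, Infty)"
        using True r u Fract_less_quotient_of [OF u r]
        by (simp add: immediate_precedents_def farey_adjacent_def u_def)
      then show ?thesis ..
    next
      case False
      define c where "c = p - a"
      define d where "d = q - b"
      have d: "d > 0" using False b by (simp add: d_def)
      have bez2: "c * q - d * p = 1"
        using bez by (simp add: c_def d_def algebra_simps)
      have copcd: "coprime c d"
      proof (rule coprimeI)
        fix e assume "e dvd c" "e dvd d"
        then have "e dvd c * q - d * p" by simp
        then show "is_unit e" using bez2 by simp
      qed
      have v: "quotient_of (Fract c d) = (c, d)"
        using copcd d by (rule quotient_of_Fract_coprime)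
      have bez3: "c * b - d * a = 1"
        using bez by (simp add: c_def d_def algebra_simps)
      have "immediate_precedents r (u, Fin (Fract c d))"
        using r u v bez bez2 bez3 Fract_less_quotient_of [OF u r] Fract_less_quotient_of [OF r v]
        by (simp add: immediate_precedents_def farey_adjacent_def u_def algebra_simps)
           (simp add: c_def d_def)
      then show ?thesis ..
    qed
  qed
  have facts: "\<exists>s a b. u = Fin s \<and> quotient_of s = (a, b) \<and> 1 \<le> b \<and> b \<le> q \<and> p * b - q * a = 1 \<and>
      farey_num v = p - a \<and> farey_den v = q - b" if uv: "immediate_precedents r (u, v)" for u v
  proof -
    obtain s where s: "u = Fin s"
      using uv by (cases u) (auto simp: immediate_precedents_def)
    obtain a b where ab: "quotient_of s = (a, b)"
      by fastforce
    have "b > 0"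
      using ab quotient_of_denom_pos by blast
    moreover have "farey_den v \<ge> 0"
      by (cases v) (auto simp: quotient_of_denom_pos' less_imp_le)
    moreover have "a * q < p * b"
      using uv s Fract_less_quotient_of [OF ab r] by (simp add: immediate_precedents_def)
    ultimately show ?thesis
      using uv s ab r
      by (auto simp: immediate_precedents_def farey_adjacent_def algebra_simps abs_if split: if_splits)
  qed
  have vertex_eqI: "v = v'" if "farey_num v = farey_num v'" "farey_den v = farey_den v'" for v v'
  proof -
    have pos: "snd (quotient_of t) \<noteq> 0" for t
      using quotient_of_denom_pos' [of t] by simp
    show ?thesis
      using that pos by (cases v; cases v') (auto intro: quotient_of_inject prod_eqI simp: pos pos [symmetric])
  qed
  have "uv = uv'" if h: "immediate_precedents r uv" "immediate_precedents r uv'" for uv uv'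
  proof -
    obtain u v u' v' where eq: "uv = (u, v)" "uv' = (u', v')"
      by fastforce
    obtain s a b where 1: "u = Fin s" "quotient_of s = (a, b)" "1 \<le> b" "b \<le> q"
      "p * b - q * a = 1" "farey_num v = p - a" "farey_den v = q - b"
      using facts [of u v] h(1) unfolding eq by blast
    obtain s' a' b' where 2: "u' = Fin s'" "quotient_of s' = (a', b')" "1 \<le> b'" "b' \<le> q"
      "p * b' - q * a' = 1" "farey_num v' = p - a'" "farey_den v' = q - b'"
      using facts [of u' v'] h(2) unfolding eq by blast
    have *: "p * (b - b') = q * (a - a')"
      using 1 2 by (simp add: algebra_simps)
    then have "q dvd b - b'"
      using cop by (metis coprime_commute coprime_dvd_mult_right_iff dvd_triv_left)
    then have "b = b'"
      using 1 2 zdvd_imp_le [of q "b - b'"] zdvd_imp_le [of q "b' - b"]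
      by (smt (verit) dvd_diff_commute)
    moreover from this have "a = a'"
      using * q by simp
    ultimately show ?thesis
      using eq 1 2 by (auto intro!: vertex_eqI quotient_of_inject)
  qed
  with ex show ?thesis by blast
qed

lemma "immediate_precedents 0 (Fin (-1), Infty)" "immediate_precedents 1 (Fin 0, Infty)"
  by (simp_all add: immediate_precedents_def farey_adjacent_def)

text \<open>Only the values on the rationals in [0,1] are of interest; the uniqueness lemma above
  justifies the definite description.\<close>

definition farey_twist :: "rat \<Rightarrow> rat" where
  "farey_twist r =
     (let (u, v) = (THE uv. immediate_precedents r uv)
      in of_int (farey_den u) / of_int (farey_den (Fin r)))"

definition farey_twist_graph :: "(real \<times> real) set" where
  "farey_twist_graph = {(of_rat r, of_rat (farey_twist r)) | r. r \<in> {0..1}}"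

end

theory Submission
  imports Defs
begin

text \<open>
  If \<open>a/b\<close> is the lower precedent of \<open>p/q\<close>, then \<open>p b - q a = 1\<close> and the twist sends \<open>p/q\<close> to
  \<open>b/q\<close>. A point of the graph is thus read off from a matrix with rows \<open>(p, a)\<close> and \<open>(q, b)\<close> in
  the group \<open>SL\<^sub>2(\<int>)\<close>, as the pair of ratios \<open>(p/q, b/q)\<close>: the first depends on the left column
  only, the second on the bottom row only. Conversely, every matrix of determinant 1 with
  \<open>0 \<le> p \<le> q\<close> and \<open>0 < b < q\<close> yields a point of the graph
  (lemma \<open>det_eq_1_in_farey_twist_graph\<close>).

  The two ratios can be prescribed independently. Let \<open>x = p\<^sub>0/q\<^sub>0\<close> and \<open>y = f/e\<close> be rationals in
  lowest terms strictly between 0 and 1. Complete the column \<open>(p\<^sub>0, q\<^sub>0)\<close> to a matrix \<open>M\<close> of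
  determinant 1 and the row \<open>(e, f)\<close>, as a top row, to a matrix \<open>N\<close> of determinant 1. With \<open>C\<^sub>n\<close> the
  matrix with rows \<open>(n, -1)\<close> and \<open>(1, 0)\<close>, the product \<open>M C\<^sub>n N\<close> has determinant 1 and equals
  \<open>n\<close> times the rank-one matrix \<open>(p\<^sub>0, q\<^sub>0)\<^sup>T (e, f)\<close> plus a matrix that does not depend on \<open>n\<close>.
  Its left column therefore has a ratio tending to \<open>p\<^sub>0/q\<^sub>0\<close> and its bottom row a ratio tending to
  \<open>f/e\<close>, so \<open>(x, y)\<close> is a limit of points of the graph
  (lemma \<open>rational_point_in_closure_farey_twist_graph\<close>). Such pairs are dense in the unit square.
\<close>

lemma farey_den_nonneg: "farey_den v \<ge> 0"
  by (cases v) (auto simp: quotient_of_denom_pos' less_imp_le)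

lemma farey_twist_eq:
  assumes "immediate_precedents r (u, v)"
  shows "farey_twist r = of_int (farey_den u) / of_int (farey_den (Fin r))"
proof -
  have "(THE uv. immediate_precedents r uv) = (u, v)"
    using assms ex1_immediate_precedents [of r] by (rule the1_equality [rotated])
  then show ?thesis
    by (simp add: farey_twist_def)
qed

lemma farey_twist_in_unit_interval: "farey_twist r \<in> {0..1}"
proof -
  obtain u v where uv: "immediate_precedents r (u, v)"
    using ex1_immediate_precedents [of r] by (metis surj_pair)
  then have "farey_den u + farey_den v = farey_den (Fin r)"
    by (simp add: immediate_precedents_def)
  then have "0 \<le> farey_den u" "farey_den u \<le> farey_den (Fin r)" "farey_den (Fin r) > 0"
    using farey_den_nonneg [of u] farey_den_nonneg [of v] quotient_of_denom_pos' [of r] by auto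
  then show ?thesis
    by (simp add: farey_twist_eq [OF uv] divide_le_eq)
qed

lemma coprime_if_det_eq_1:
  fixes a b c d :: int
  assumes "a * d - b * c = 1"
  shows "coprime a b"
proof (rule coprimeI)
  fix k assume "k dvd a" "k dvd b"
  then have "k dvd a * d - b * c" by simp
  then show "is_unit k" using assms by simp
qed

text \<open>
  The upper precedent is \<open>(p - a)/(q - b)\<close>; all three adjacencies among the precedents and \<open>p/q\<close>
  come from the one determinant, since subtracting one column from the other preserves it. Strictness of
  \<open>b < q\<close> keeps the upper precedent away from \<open>Infty\<close>.
\<close>

lemma farey_twist_Fract:
  fixes p q a b :: int
  assumes det: "p * b - q * a = 1" and b: "0 < b" "b < q"
  shows "farey_twist (Fract p q) = of_int b / of_int q"
proof -
  have r: "quotient_of (Fract p q) = (p, q)"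
    using b coprime_if_det_eq_1 [OF det] by (intro quotient_of_Fract_coprime) auto
  have "b * p - a * q = 1"
    using det by (simp add: algebra_simps)
  then have u: "quotient_of (Fract a b) = (a, b)"
    using b coprime_if_det_eq_1 coprime_commute
    by (intro quotient_of_Fract_coprime) blast+
  have "(p - a) * b - (q - b) * a = 1"
    using det by (simp add: algebra_simps)
  then have v: "quotient_of (Fract (p - a) (q - b)) = (p - a, q - b)"
    using b coprime_if_det_eq_1 by (intro quotient_of_Fract_coprime) (blast, simp)
  have "immediate_precedents (Fract p q) (Fin (Fract a b), Fin (Fract (p - a) (q - b)))"
    using r u v det Fract_less_quotient_of [OF u r] Fract_less_quotient_of [OF r v]
    by (simp add: immediate_precedents_def farey_adjacent_def algebra_simps)
  from farey_twist_eq [OF this] show ?thesis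
    by (simp add: r u)
qed

lemma det_eq_1_in_farey_twist_graph:
  fixes p q a b :: int
  assumes "p * b - q * a = 1" "0 \<le> p" "p \<le> q" "0 < b" "b < q"
  shows "(real_of_int p / real_of_int q, real_of_int b / real_of_int q) \<in> farey_twist_graph"
proof -
  have "Fract p q \<in> {0..1}"
    using assms by (simp add: Fract_of_int_quotient divide_le_eq)
  moreover have "real_of_rat (Fract p q) = p / q"
    using assms by (simp add: of_rat_rat)
  moreover have "real_of_rat (farey_twist (Fract p q)) = b / q"
    using assms by (simp add: farey_twist_Fract of_rat_divide)
  ultimately show ?thesis
    unfolding farey_twist_graph_def by (metis (mono_tags, lifting) mem_Collect_eq)
qed

lemma tendsto_ratio_of_linear:
  fixes A B c d :: real
  assumes "B \<noteq> 0"
  shows "(\<lambda>n. (real n * A + c) / (real n * B + d)) \<longlonglongrightarrow> A / B"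
proof -
  have "(\<lambda>n. (A + c / real n) / (B + d / real n)) \<longlonglongrightarrow> (A + 0) / (B + 0)"
    using assms by (intro tendsto_intros lim_const_over_n) auto
  moreover have "\<forall>\<^sub>F n in sequentially.
      (A + c / real n) / (B + d / real n) = (real n * A + c) / (real n * B + d)"
    using eventually_gt_at_top [of 0]
  proof eventually_elim
    case (elim n)
    have "(real n * (A + c / real n)) / (real n * (B + d / real n))
        = (A + c / real n) / (B + d / real n)"
      using elim by (intro mult_divide_mult_cancel_left) auto
    with elim show ?case
      by (simp add: distrib_left)
  qed
  ultimately show ?thesis
    by (auto elim: Lim_transform_eventually)
qed

lemma rat_lowest_terms_completion:
  fixes x :: rat
  assumes "0 < x"
  obtains p q a b :: int
  where "0 < p" "0 < q" "p * b - q * a = 1" "real_of_rat x = p / q"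
proof -
  obtain p q where pq: "quotient_of x = (p, q)"
    by fastforce
  then have q: "0 < q" and cop: "coprime p q" and x: "x = of_int p / of_int q"
    using quotient_of_denom_pos quotient_of_coprime quotient_of_div by blast+
  obtain b c where "b * p + c * q = 1"
    using bezout_int [of p q] cop by auto
  then have "p * b - q * (- c) = 1"
    by (simp add: algebra_simps)
  moreover have "0 < p"
    using assms q by (simp add: x zero_less_divide_iff)
  ultimately show thesis
    using q x by (intro that [of p q b "- c"]) (simp_all add: of_rat_divide)
qed

text \<open>
  The integers \<open>P n\<close>, \<open>Q n\<close>, \<open>A n\<close>, \<open>B n\<close> below are the entries of \<open>M C\<^sub>n N\<close>. Both limits lie
  strictly between 0 and 1, which is why the range conditions on the entries hold for large \<open>n\<close>.
\<close>

lemma rational_point_in_closure_farey_twist_graph: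
  fixes x y :: rat
  assumes x: "0 < x" "x < 1" and y: "0 < y" "y < 1"
  shows "(real_of_rat x, real_of_rat y) \<in> closure farey_twist_graph"
proof -
  obtain p0 q0 a0 b0 :: int where M: "0 < p0" "0 < q0" "p0 * b0 - q0 * a0 = 1"
    and x_eq: "real_of_rat x = p0 / q0"
    using rat_lowest_terms_completion [OF x(1)] .
  obtain f e h' g' :: int where N': "0 < f" "0 < e" "f * g' - e * h' = 1"
    and y_eq: "real_of_rat y = f / e"
    using rat_lowest_terms_completion [OF y(1)] .
  \<comment> \<open>Here \<open>f/e\<close> is a ratio inside a row rather than a column, and the row is the top one with
    \<open>e\<close> first, so the completing entries change sign.\<close>
  define g h where "g = - g'" and "h = - h'"
  have det_N: "e * h - f * g = 1"
    using N'(3) by (simp add: g_def h_def)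
  define P where "P n = (int n * p0 + a0) * e - p0 * g" for n
  define Q where "Q n = (int n * q0 + b0) * e - q0 * g" for n
  define A where "A n = (int n * p0 + a0) * f - p0 * h" for n
  define B where "B n = (int n * q0 + b0) * f - q0 * h" for n
  have det: "P n * B n - Q n * A n = 1" for n
  proof -
    have "P n * B n - Q n * A n = (p0 * b0 - q0 * a0) * (e * h - f * g)"
      unfolding P_def Q_def A_def B_def by algebra
    then show ?thesis
      by (simp add: M(3) det_N)
  qed
  have P_real: "real_of_int (P n) = real n * (p0 * e) + (a0 * e - p0 * g)"
    and Q_real: "real_of_int (Q n) = real n * (q0 * e) + (b0 * e - q0 * g)"
    and B_real: "real_of_int (B n) = real n * (q0 * f) + (b0 * f - q0 * h)" for n
    by (simp_all add: P_def Q_def B_def algebra_simps)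
  have "(\<lambda>n. real_of_int (P n) / Q n) \<longlonglongrightarrow> real_of_int (p0 * e) / (q0 * e)"
    unfolding P_real Q_real using M N' by (intro tendsto_ratio_of_linear) auto
  then have limP: "(\<lambda>n. real_of_int (P n) / Q n) \<longlonglongrightarrow> real_of_rat x"
    using N' by (simp add: x_eq)
  have "(\<lambda>n. real_of_int (B n) / Q n) \<longlonglongrightarrow> real_of_int (q0 * f) / (q0 * e)"
    unfolding B_real Q_real using M N' by (intro tendsto_ratio_of_linear) auto
  then have limB: "(\<lambda>n. real_of_int (B n) / Q n) \<longlonglongrightarrow> real_of_rat y"
    using M by (simp add: y_eq)
  have Q_pos: "\<forall>\<^sub>F n in sequentially. 0 < Q n"
    using eventually_gt_at_top [of "nat \<bar>b0 * e - q0 * g\<bar>"]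
  proof eventually_elim
    case (elim n)
    have "int n * 1 \<le> int n * (q0 * e)"
      using M N' by (intro mult_left_mono) (auto simp: int_one_le_iff_zero_less)
    moreover have "Q n = int n * (q0 * e) + (b0 * e - q0 * g)"
      by (simp add: Q_def algebra_simps)
    ultimately show ?case
      using elim by linarith
  qed
  have P_pos: "\<forall>\<^sub>F n in sequentially. 0 < real_of_int (P n) / Q n"
    and P_less: "\<forall>\<^sub>F n in sequentially. real_of_int (P n) / Q n < 1"
    using x by (auto intro: order_tendstoD [OF limP])
  have B_pos: "\<forall>\<^sub>F n in sequentially. 0 < real_of_int (B n) / Q n"
    and B_less: "\<forall>\<^sub>F n in sequentially. real_of_int (B n) / Q n < 1"
    using y by (auto intro: order_tendstoD [OF limB])
  have "\<forall>\<^sub>F n in sequentially. (real_of_int (P n) / Q n, real_of_int (B n) / Q n) \<in> farey_twist_graph"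
    using Q_pos P_pos P_less B_pos B_less
  proof eventually_elim
    case (elim n)
    then have "0 < P n" "P n < Q n" "0 < B n" "B n < Q n"
      using x y by (auto simp: zero_less_divide_iff divide_less_eq)
    then show ?case
      using det [of n] by (intro det_eq_1_in_farey_twist_graph [where a = "A n"]) auto
  qed
  then have "\<forall>\<^sub>F n in sequentially.
      (real_of_int (P n) / Q n, real_of_int (B n) / Q n) \<in> closure farey_twist_graph"
    by (rule eventually_mono) (use closure_subset in blast)
  moreover have "(\<lambda>n. (real_of_int (P n) / Q n, real_of_int (B n) / Q n))
      \<longlonglongrightarrow> (real_of_rat x, real_of_rat y)"
    using limP limB by (rule tendsto_Pair)
  ultimately show ?thesis
    by (intro Lim_in_closed_set [OF closed_closure _ sequentially_bot])
qed

lemma closure_rationals_unit_interval: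
  "{0..1} \<subseteq> closure (real_of_rat ` {0<..<1})"
proof -
  have "x \<in> closure (real_of_rat ` {0<..<1})" if x: "x \<in> {0<..<1}" for x :: real
  proof (subst closure_approachable, intro allI impI)
    fix \<epsilon> :: real assume "0 < \<epsilon>"
    then have "max 0 (x - \<epsilon>) < x"
      using x by auto
    then obtain r where r: "max 0 (x - \<epsilon>) < real_of_rat r" "real_of_rat r < x"
      using of_rat_dense by blast
    then have "0 < real_of_rat r" "real_of_rat r < 1"
      using x by (simp_all del: zero_less_of_rat_iff of_rat_less_1_iff)
    then have "r \<in> {0<..<1}"
      by simp
    moreover have "dist (real_of_rat r) x < \<epsilon>"
      using r by (simp add: dist_real_def)
    ultimately show "\<exists>z\<in>real_of_rat ` {0<..<1}. dist z x < \<epsilon>"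
      by blast
  qed
  then have "closure {0<..<1::real} \<subseteq> closure (real_of_rat ` {0<..<1})"
    by (intro closure_minimal) auto
  then show ?thesis
    by simp
qed

theorem theorem1p3:
  shows "farey_twist_graph \<subseteq> {0..1} \<times> {0..1} \<and> {0..1} \<times> {0..1} \<subseteq> closure farey_twist_graph"
proof
  show "farey_twist_graph \<subseteq> {0..1} \<times> {0..1}"
    using farey_twist_in_unit_interval by (auto simp: farey_twist_graph_def)
  let ?R = "real_of_rat ` {0<..<1}"
  have "{0..1} \<times> {0..1} \<subseteq> closure (?R \<times> ?R)"
    unfolding closure_Times using closure_rationals_unit_interval by blast
  also have "\<dots> \<subseteq> closure farey_twist_graph"
    by (intro closure_minimal) (auto intro: rational_point_in_closure_farey_twist_graph)
  finally show "{0..1} \<times> {0..1} \<subseteq> closure farey_twist_graph" .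
qed

end
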